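(* Let $S$ be an infinite set, let $(R_k)_{k\in S}$ be a family of nonzero commutative rings, and let $R=\prod_{k\in S}R_k$. Then the set of connected components of $\operatorname{Spec}(R)$ has cardinality $\geqslant 2^{2^{|S|}}$. If moreover each $R_k$ has only finitely many idempotents, then the set of connected components of $\operatorname{Spec}(R)$ has cardinality equal to $2^{2^{|S|}}$.
   Context: All rings are commutative with identity; $\operatorname{Spec}(R)$ carries the Zariski topology. *)

theory Defs
  imports
    "HOL-Algebra.Ideal"
    "HOL-Library.FuncSet"
    "HOL-Library.Equipollence"
    "HOL-Analysis.Abstract_Topology_2"
begin

(* The ring analogue of product_group of HOL-Algebra.Product_Groups. *)
definition product_ring :: "'i set \<Rightarrow> ('i \<Rightarrow> ('a, 'm) ring_scheme) \<Rightarrow> ('i \<Rightarrow> 'a) ring"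
  where "product_ring I R =
    \<lparr>carrier = (\<Pi>\<^sub>E i\<in>I. carrier (R i)),
     monoid.mult = (\<lambda>x y. \<lambda>i\<in>I. x i \<otimes>\<^bsub>R i\<^esub> y i),
     one = (\<lambda>i\<in>I. \<one>\<^bsub>R i\<^esub>),
     zero = (\<lambda>i\<in>I. \<zero>\<^bsub>R i\<^esub>),
     add = (\<lambda>x y. \<lambda>i\<in>I. x i \<oplus>\<^bsub>R i\<^esub> y i)\<rparr>"

lemma cring_product_ring:
  fixes I :: "'i set" and R :: "'i \<Rightarrow> ('a, 'm) ring_scheme"
  assumes R: "\<And>i. i \<in> I \<Longrightarrow> cring (R i)"
  shows "cring (product_ring I R)"
proof -
  have inverse_ex: "\<exists>y\<in>carrier (product_ring I R). y \<oplus>\<^bsub>product_ring I R\<^esub> x = \<zero>\<^bsub>product_ring I R\<^esub>"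
    if "x \<in> carrier (product_ring I R)" for x
  proof
    show "(\<lambda>i\<in>I. \<ominus>\<^bsub>R i\<^esub> x i) \<in> carrier (product_ring I R)"
      using that by (auto simp: product_ring_def PiE_iff cring.cring_simprules(3) R)
    show "(\<lambda>i\<in>I. \<ominus>\<^bsub>R i\<^esub> x i) \<oplus>\<^bsub>product_ring I R\<^esub> x = \<zero>\<^bsub>product_ring I R\<^esub>"
      using that by (auto simp: product_ring_def PiE_iff cring.cring_simprules(9) R fun_eq_iff)
  qed
  have ext: "x i = undefined" if "x \<in> extensional I" "i \<notin> I" for x :: "'i \<Rightarrow> 'a" and i
    using that by (rule extensional_arb)
  have group: "abelian_group (product_ring I R)"
    by (rule abelian_groupI; (rule inverse_ex)?)
      (simp_all add: product_ring_def PiE_iff fun_eq_iff ext R cring.cring_simprules(1,2,7,8,10,16,23))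
  have r_one: "x \<otimes>\<^bsub>R i\<^esub> \<one>\<^bsub>R i\<^esub> = x" if "i \<in> I" "x \<in> carrier (R i)" for i x
    using R[OF that(1)] that(2) by (simp add: cring_def ring.is_monoid monoid.r_one)
  have monoid: "comm_monoid (product_ring I R)"
    by (rule comm_monoidI)
      (simp_all add: product_ring_def PiE_iff fun_eq_iff ext R r_one cring.cring_simprules(5,6,11,12,14,24))
  show ?thesis
    by (rule cringI[OF group monoid])
      (simp add: product_ring_def PiE_iff fun_eq_iff R cring.cring_simprules(13))
qed

definition idempotents :: "('a, 'm) ring_scheme \<Rightarrow> 'a set"
  where "idempotents R = {e \<in> carrier R. e \<otimes>\<^bsub>R\<^esub> e = e}"

definition prime_spectrum :: "('a, 'm) ring_scheme \<Rightarrow> 'a set set"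
  where "prime_spectrum R = {P. primeideal P R}"

definition vanishing_locus :: "('a, 'm) ring_scheme \<Rightarrow> 'a set \<Rightarrow> 'a set set"
  where "vanishing_locus R E = {P \<in> prime_spectrum R. E \<subseteq> P}"

definition zariski_topology :: "('a, 'm) ring_scheme \<Rightarrow> 'a set topology"
  where "zariski_topology R =
    topology (\<lambda>U. \<exists>E\<subseteq>carrier R. U = prime_spectrum R - vanishing_locus R E)"

(* The constructor topology is only meaningful on families satisfying istopology. *)
lemma istopology_zariski:
  "istopology (\<lambda>U. \<exists>E\<subseteq>carrier R. U = prime_spectrum R - vanishing_locus R E)"
  unfolding istopology_def
proof (intro conjI allI impI)
  fix U V
  assume "\<exists>E\<subseteq>carrier R. U = prime_spectrum R - vanishing_locus R E"
    and "\<exists>E\<subseteq>carrier R. V = prime_spectrum R - vanishing_locus R E"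
  then obtain E F
    where EF: "E \<subseteq> carrier R" "U = prime_spectrum R - vanishing_locus R E"
      "F \<subseteq> carrier R" "V = prime_spectrum R - vanishing_locus R F"
    by blast
  show "\<exists>E\<subseteq>carrier R. U \<inter> V = prime_spectrum R - vanishing_locus R E"
  proof (cases "cring R")
    case True
    then interpret cring R .
    define G where "G = {a \<otimes>\<^bsub>R\<^esub> b | a b. a \<in> E \<and> b \<in> F}"
    have G: "G \<subseteq> carrier R"
      using EF by (auto simp: G_def)
    have "G \<subseteq> P \<longleftrightarrow> E \<subseteq> P \<or> F \<subseteq> P" if "primeideal P R" for P
    proof -
      interpret P: primeideal P R by fact
      show ?thesis
      proof
        assume GP: "G \<subseteq> P"
        show "E \<subseteq> P \<or> F \<subseteq> P"
        proof (rule ccontr)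
          assume "\<not> (E \<subseteq> P \<or> F \<subseteq> P)"
          then obtain a b where ab: "a \<in> E" "a \<notin> P" "b \<in> F" "b \<notin> P"
            by blast
          then have "a \<otimes>\<^bsub>R\<^esub> b \<in> P"
            using GP by (auto simp: G_def)
          with ab EF show False
            using P.I_prime[of a b] by blast
        qed
      next
        assume "E \<subseteq> P \<or> F \<subseteq> P"
        then show "G \<subseteq> P"
          using EF unfolding G_def by (blast intro: P.I_l_closed P.I_r_closed)
      qed
    qed
    then have "U \<inter> V = prime_spectrum R - vanishing_locus R G"
      using EF by (auto simp: vanishing_locus_def prime_spectrum_def)
    then show ?thesis
      using G by blast
  next
    case False
    then have "prime_spectrum R = {}"
      by (auto simp: prime_spectrum_def primeideal_def)
    then show ?thesis
      using EF by auto
  qed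
next
  fix \<K>
  assume "\<forall>K\<in>\<K>. \<exists>E\<subseteq>carrier R. K = prime_spectrum R - vanishing_locus R E"
  then obtain E where E: "\<And>K. K \<in> \<K> \<Longrightarrow> E K \<subseteq> carrier R"
    "\<And>K. K \<in> \<K> \<Longrightarrow> K = prime_spectrum R - vanishing_locus R (E K)"
    by metis
  have "P \<in> \<Union>\<K> \<longleftrightarrow> P \<in> prime_spectrum R - vanishing_locus R (\<Union>K\<in>\<K>. E K)" for P
  proof -
    have "P \<in> \<Union>\<K> \<longleftrightarrow> (\<exists>K\<in>\<K>. P \<in> prime_spectrum R - vanishing_locus R (E K))"
      using E(2) by blast
    then show ?thesis
      by (auto simp: vanishing_locus_def)
  qed
  then show "\<exists>E\<subseteq>carrier R. \<Union>\<K> = prime_spectrum R - vanishing_locus R E"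
    using E(1) by (intro exI[where x = "\<Union>K\<in>\<K>. E K"]) blast
qed

lemma openin_zariski:
  "openin (zariski_topology R) U \<longleftrightarrow>
    (\<exists>E\<subseteq>carrier R. U = prime_spectrum R - vanishing_locus R E)"
  by (simp add: zariski_topology_def topology_inverse'[OF istopology_zariski])

lemma topspace_zariski: "topspace (zariski_topology R) = prime_spectrum R"
proof -
  have "prime_spectrum R = prime_spectrum R - vanishing_locus R (carrier R)"
    by (auto simp: vanishing_locus_def prime_spectrum_def primeideal_def primeideal_axioms_def
        ideal_def additive_subgroup_def dest: subgroup.subset)
  then have "openin (zariski_topology R) (prime_spectrum R)"
    unfolding openin_zariski by blast
  moreover have "topspace (zariski_topology R) \<subseteq> prime_spectrum R"
    using openin_topspace[of "zariski_topology R"] unfolding openin_zariski by blast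
  ultimately show ?thesis
    by (simp add: openin_subset subset_antisym)
qed

end

theory Submission
  imports Defs
    "HOL-Algebra.Ring_Divisibility"
    "HOL-Algebra.Free_Abelian_Groups"
    "HOL-Analysis.Abstract_Topological_Spaces"
begin

text \<open>Two primes lie in the same connected component of a spectrum iff they contain the same
  idempotents. In a product of nonzero rings the idempotents include the indicators of subsets of
  \<open>S\<close>, so an independent family of \<open>2^|S|\<close> subsets gives \<open>2^(2^|S|)\<close> primes that are pairwise
  separated by idempotents. If every factor has finitely many idempotents, the product has at most
  \<open>2^|S|\<close> of them, which bounds the number of components from above.\<close>

section \<open>Prime ideals\<close>

text \<open>Additive inverses are multiples by \<open>\<ominus> \<one>\<close>, and absorption on
  the other side follows from commutativity.\<close>

lemma (in cring) ideal_cringI: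
  assumes "I \<subseteq> carrier R" "\<zero> \<in> I"
    and add: "\<And>a b. a \<in> I \<Longrightarrow> b \<in> I \<Longrightarrow> a \<oplus> b \<in> I"
    and mult: "\<And>a x. a \<in> I \<Longrightarrow> x \<in> carrier R \<Longrightarrow> x \<otimes> a \<in> I"
  shows "ideal I R"
proof (rule idealI[OF ring_axioms])
  have "\<ominus> a \<in> I" if "a \<in> I" for a
    using mult[OF that, of "\<ominus> \<one>"] that assms(1) by (auto simp: l_minus)
  then show "subgroup I (add_monoid R)"
    using assms by (intro add.subgroupI) (auto simp: a_inv_def)
  show "a \<otimes> x \<in> I" if "a \<in> I" "x \<in> carrier R" for a x
    using mult[OF that] that assms(1) m_comm[of a x] by auto
qed (use mult in auto)

lemma (in ideal) add_mem: "a \<in> I \<Longrightarrow> b \<in> I \<Longrightarrow> a \<oplus> b \<in> I"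
  by (rule additive_subgroup.a_closed[OF is_additive_subgroup])

lemma (in ring) ideal_set_add_supset:
  assumes "ideal I R" "ideal J R"
  shows "I \<subseteq> I <+>\<^bsub>R\<^esub> J" "J \<subseteq> I <+>\<^bsub>R\<^esub> J"
proof -
  interpret I: ideal I R by fact
  interpret J: ideal J R by fact
  show "I \<subseteq> I <+>\<^bsub>R\<^esub> J"
  proof
    fix a assume "a \<in> I"
    then have "a = a \<oplus> \<zero>" using I.Icarr by simp
    then show "a \<in> I <+>\<^bsub>R\<^esub> J"
      using \<open>a \<in> I\<close> J.zero_closed unfolding set_add_def' by blast
  qed
  show "J \<subseteq> I <+>\<^bsub>R\<^esub> J"
  proof
    fix a assume "a \<in> J"
    then have "a = \<zero> \<oplus> a" using J.Icarr by simp
    then show "a \<in> I <+>\<^bsub>R\<^esub> J"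
      using \<open>a \<in> J\<close> I.zero_closed unfolding set_add_def' by blast
  qed
qed

text \<open>By Zorn, some ideal is maximal among those containing \<open>I\<close> and missing every
  power of \<open>x\<close>; such an ideal is prime. With \<open>x = \<one>\<close> this gives a
  prime above any proper ideal; for general \<open>x\<close> it shows that an element of all primes
  above \<open>I\<close> is nilpotent modulo \<open>I\<close>.\<close>

lemma (in cring) exists_primeideal_notin:
  assumes I: "ideal I R" and x: "x \<in> carrier R" and pow: "\<And>n::nat. x [^] n \<notin> I"
  shows "\<exists>P. primeideal P R \<and> I \<subseteq> P \<and> x \<notin> P"
proof -
  define \<A> where "\<A> = {J. ideal J R \<and> I \<subseteq> J \<and> (\<forall>n::nat. x [^] n \<notin> J)}"
  have "\<exists>M\<in>\<A>. \<forall>J\<in>\<A>. M \<subseteq> J \<longrightarrow> J = M"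
  proof (rule subset_Zorn_nonempty)
    show "\<A> \<noteq> {}" using I pow by (auto simp: \<A>_def)
  next
    fix \<C> assume C: "\<C> \<noteq> {}" "subset.chain \<A> \<C>"
    then have "subset.chain {I. ideal I R} \<C>"
      by (auto simp: subset_chain_def \<A>_def)
    then have "ideal (\<Union>\<C>) R"
      using chain_Union_is_ideal[of \<C>] C(1) by simp
    moreover have "I \<subseteq> J" "\<forall>n::nat. x [^] n \<notin> J" if "J \<in> \<C>" for J
      using C(2) that by (auto simp: subset_chain_def \<A>_def)
    then have "I \<subseteq> \<Union>\<C>" "\<forall>n::nat. x [^] n \<notin> \<Union>\<C>"
      using C(1) by blast+
    ultimately show "\<Union>\<C> \<in> \<A>"
      by (simp add: \<A>_def)
  qed
  then obtain M where M: "M \<in> \<A>" and max: "\<And>J. J \<in> \<A> \<Longrightarrow> M \<subseteq> J \<Longrightarrow> J = M"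
    by blast
  then interpret M: ideal M R by (simp add: \<A>_def)
  have IM: "I \<subseteq> M" and powM: "\<And>n::nat. x [^] n \<notin> M"
    using M by (auto simp: \<A>_def)
  \<comment> \<open>By maximality, enlarging \<open>M\<close> by an outside element \<open>a\<close>
    must capture a power of \<open>x\<close>.\<close>
  have *: "\<exists>n::nat. \<exists>m\<in>M. \<exists>r\<in>carrier R. x [^] n = m \<oplus> r \<otimes> a"
    if a: "a \<in> carrier R" "a \<notin> M" for a
  proof -
    let ?J = "M <+>\<^bsub>R\<^esub> PIdl a"
    have J: "ideal ?J R" using add_ideals[OF M.is_ideal cgenideal_ideal[OF a(1)]] .
    have "M \<subseteq> ?J" "PIdl a \<subseteq> ?J"
      using ideal_set_add_supset M.is_ideal cgenideal_ideal[OF a(1)] by blast+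
    moreover have "a \<in> PIdl a" using cgenideal_self a(1) .
    ultimately have "?J \<notin> \<A>" using max[of ?J] a by blast
    then have "\<exists>n::nat. x [^] n \<in> ?J"
      using J IM \<open>M \<subseteq> ?J\<close> unfolding \<A>_def by blast
    then show ?thesis unfolding set_add_def' cgenideal_def by blast
  qed
  have "primeideal M R"
  proof (rule primeidealI[OF M.is_ideal is_cring])
    show "carrier R \<noteq> M" using powM[of 0] by auto
  next
    fix a b assume ab: "a \<in> carrier R" "b \<in> carrier R" "a \<otimes> b \<in> M"
    show "a \<in> M \<or> b \<in> M"
    proof (rule ccontr)
      assume "\<not> (a \<in> M \<or> b \<in> M)"
      then obtain n n' :: nat and m m' r r' where
        m: "m \<in> M" "r \<in> carrier R" "x [^] n = m \<oplus> r \<otimes> a" and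
        m': "m' \<in> M" "r' \<in> carrier R" "x [^] n' = m' \<oplus> r' \<otimes> b"
        using * ab by meson
      have c: "m \<in> carrier R" "m' \<in> carrier R" using m m' M.Icarr by auto
      \<comment> \<open>After expansion each summand has a factor \<open>m\<close>,
        \<open>m'\<close> or \<open>a \<otimes> b\<close>, all in \<open>M\<close>, so
        \<open>M\<close> would contain a power of \<open>x\<close>.\<close>
      have "x [^] (n + n') = (m \<oplus> r \<otimes> a) \<otimes> (m' \<oplus> r' \<otimes> b)"
        using m m' x by (simp flip: nat_pow_mult)
      also have "\<dots> = m \<otimes> (m' \<oplus> r' \<otimes> b) \<oplus> (r \<otimes> a) \<otimes> m' \<oplus> (r \<otimes> r') \<otimes> (a \<otimes> b)"
        using m m' ab c by algebra
      also have "\<dots> \<in> M"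
      proof (intro M.add_mem)
        show "m \<otimes> (m' \<oplus> r' \<otimes> b) \<in> M" using m m' ab c by (intro M.I_r_closed) auto
        show "(r \<otimes> a) \<otimes> m' \<in> M" using m m' ab c by (intro M.I_l_closed) auto
        show "(r \<otimes> r') \<otimes> (a \<otimes> b) \<in> M"
          by (rule M.I_l_closed) (use m m' ab in auto)
      qed
      finally show False using powM by blast
    qed
  qed
  then show ?thesis using IM powM[of 1] x by auto
qed

lemma (in primeideal) one_notin: "\<one> \<notin> I"
  using one_imp_carrier I_notcarr by blast

lemma (in primeideal) nat_pow_mem:
  assumes "x \<in> carrier R" "x [^] (n::nat) \<in> I"
  shows "x \<in> I"
  using assms(2)
proof (induction n)
  case (Suc n)
  then show ?case using I_prime[of "x [^] n" x] assms(1) by auto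
qed (use one_notin in simp)

section \<open>Idempotents and connected components of the spectrum\<close>

lemma (in cring) idempotent_compl:
  assumes "e \<in> idempotents R"
  shows "\<one> \<ominus> e \<in> idempotents R" and "e \<otimes> (\<one> \<ominus> e) = \<zero>" and "e \<oplus> (\<one> \<ominus> e) = \<one>"
proof -
  have e: "e \<in> carrier R" "e \<otimes> e = e" using assms by (auto simp: idempotents_def)
  show s: "e \<oplus> (\<one> \<ominus> e) = \<one>" using e(1) by algebra
  have "e \<otimes> (\<one> \<ominus> e) = e \<ominus> e \<otimes> e" using e(1) by algebra
  then show z: "e \<otimes> (\<one> \<ominus> e) = \<zero>" using e by simp
  have "(\<one> \<ominus> e) \<otimes> (\<one> \<ominus> e) = (\<one> \<ominus> e) \<ominus> e \<otimes> (\<one> \<ominus> e)" using e(1) by algebra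
  then show "\<one> \<ominus> e \<in> idempotents R" using e z by (simp add: idempotents_def minus_eq)
qed

text \<open>The zero product forces one of the two elements into the prime; the sum 1 prevents both
  from lying there.\<close>

lemma (in primeideal) compl_mem_iff:
  assumes "e \<in> carrier R" "f \<in> carrier R" "e \<otimes> f = \<zero>" "e \<oplus> f = \<one>"
  shows "f \<in> I \<longleftrightarrow> e \<notin> I"
  using assms I_prime[of e f] one_notin zero_closed add_mem[of e f] by auto

lemma closedin_zariski_vanishing_locus:
  assumes "E \<subseteq> carrier R"
  shows "closedin (zariski_topology R) (vanishing_locus R E)"
  using assms by (auto simp: closedin_def topspace_zariski openin_zariski vanishing_locus_def)

lemma closedin_zariskiE:
  assumes "closedin (zariski_topology R) C"
  obtains E where "E \<subseteq> carrier R" "C = vanishing_locus R E"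
proof -
  obtain E where "E \<subseteq> carrier R" "prime_spectrum R - C = prime_spectrum R - vanishing_locus R E"
    and "C \<subseteq> prime_spectrum R"
    using assms by (auto simp: closedin_def topspace_zariski openin_zariski)
  then have "C = vanishing_locus R E"
    by (auto simp: vanishing_locus_def)
  then show ?thesis using that \<open>E \<subseteq> carrier R\<close> by blast
qed

text \<open>For an idempotent \<open>e\<close>, the set V(e) is clopen because its complement is V(1
  - e); a connected set therefore lies entirely on one side.\<close>

lemma (in cring) connected_component_imp_idempotents_eq:
  assumes "connected_component_of (zariski_topology R) P Q"
  shows "idempotents R \<inter> P = idempotents R \<inter> Q"
proof -
  obtain T where T: "connectedin (zariski_topology R) T" "P \<in> T" "Q \<in> T"
    using assms by (auto simp: connected_component_of_def)
  have TS: "T \<subseteq> prime_spectrum R"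
    using connectedin_subset_topspace[OF T(1)] by (simp add: topspace_zariski)
  have "e \<in> P \<longleftrightarrow> e \<in> Q" if e: "e \<in> idempotents R" for e
  proof -
    note compl = idempotent_compl[OF e]
    let ?V = "vanishing_locus R {e}"
    have c: "e \<in> carrier R" "\<one> \<ominus> e \<in> carrier R"
      using e compl by (auto simp: idempotents_def)
    have "prime_spectrum R - ?V = vanishing_locus R {\<one> \<ominus> e}"
      using c compl primeideal.compl_mem_iff[of _ R e "\<one> \<ominus> e"]
      by (auto simp: vanishing_locus_def prime_spectrum_def)
    then have "openin (zariski_topology R) ?V"
      using closedin_zariski_vanishing_locus[of "{\<one> \<ominus> e}" R] c
      by (simp add: openin_closedin_eq topspace_zariski) (auto simp: vanishing_locus_def)
    then have "T \<subseteq> ?V \<or> disjnt T ?V"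
      using connectedin_clopen_cases[OF T(1) closedin_zariski_vanishing_locus] c by blast
    then show ?thesis
      using T(2,3) TS by (auto simp: vanishing_locus_def disjnt_iff)
  qed
  then show ?thesis by blast
qed

text \<open>A prime containing both powers would contain \<open>a\<close> and \<open>b\<close>,
  hence 1; so the two powers generate the unit ideal.\<close>

lemma (in cring) comaximal_nat_pow:
  assumes ab: "a \<in> carrier R" "b \<in> carrier R" "a \<oplus> b = \<one>"
  shows "\<exists>c\<in>carrier R. \<exists>d\<in>carrier R. a [^] (n::nat) \<otimes> c \<oplus> b [^] n \<otimes> d = \<one>"
proof -
  let ?J = "PIdl (a [^] n) <+>\<^bsub>R\<^esub> PIdl (b [^] n)"
  have J: "ideal ?J R" using ab by (intro add_ideals cgenideal_ideal) auto
  have "\<one> \<in> ?J"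
  proof (rule ccontr)
    assume "\<one> \<notin> ?J"
    then obtain P where P: "primeideal P R" "?J \<subseteq> P"
      using exists_primeideal_notin[OF J, of \<one>] by auto
    interpret P: primeideal P R by fact
    have c: "a [^] n \<in> carrier R" "b [^] n \<in> carrier R" using ab by auto
    have "a [^] n \<in> P" "b [^] n \<in> P"
      using ideal_set_add_supset[OF cgenideal_ideal[OF c(1)] cgenideal_ideal[OF c(2)]]
        cgenideal_self[OF c(1)] cgenideal_self[OF c(2)] P(2) by (meson subsetD)+
    then have "a \<in> P" "b \<in> P" by (auto intro: P.nat_pow_mem[OF ab(1)] P.nat_pow_mem[OF ab(2)])
    then show False using P.add_mem[of a b] ab P.one_notin by simp
  qed
  then obtain c d where "c \<in> carrier R" "d \<in> carrier R" "\<one> = c \<otimes> a [^] n \<oplus> d \<otimes> b [^] n"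
    unfolding set_add_def' cgenideal_def by blast
  then show ?thesis using ab by (metis m_comm nat_pow_closed)
qed

section \<open>The ideal cutting out a connected component\<close>

text \<open>The union of the annihilators of the idempotents outside \<open>P\<close> is the ideal generated by the idempotents
  in \<open>P\<close>; describing it through annihilators makes closure under addition immediate.\<close>

definition idempotent_ideal :: "('a, 'm) ring_scheme \<Rightarrow> 'a set \<Rightarrow> 'a set"
  where "idempotent_ideal R P =
    {y \<in> carrier R. \<exists>u \<in> idempotents R - P. y \<otimes>\<^bsub>R\<^esub> u = \<zero>\<^bsub>R\<^esub>}"

text \<open>If \<open>u\<close> kills \<open>a\<close> and \<open>v\<close> kills \<open>b\<close>,
  then the idempotent \<open>u \<otimes> v\<close> kills \<open>a \<oplus> b\<close>, and it stays
  outside \<open>P\<close> by primality.\<close>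

lemma (in cring) ideal_idempotent_ideal:
  assumes P: "primeideal P R"
  shows "ideal (idempotent_ideal R P) R"
proof (rule ideal_cringI)
  interpret P: primeideal P R by fact
  have "\<one> \<in> idempotents R - P" "\<zero> \<otimes> \<one> = \<zero>"
    using P.one_notin by (simp_all add: idempotents_def)
  then show "\<zero> \<in> idempotent_ideal R P" unfolding idempotent_ideal_def by blast
next
  interpret P: primeideal P R by fact
  fix a b assume "a \<in> idempotent_ideal R P" "b \<in> idempotent_ideal R P"
  then obtain u v where a: "a \<in> carrier R" "u \<in> carrier R" "u \<otimes> u = u" "u \<notin> P" "a \<otimes> u = \<zero>"
    and b: "b \<in> carrier R" "v \<in> carrier R" "v \<otimes> v = v" "v \<notin> P" "b \<otimes> v = \<zero>"
    by (auto simp: idempotent_ideal_def idempotents_def)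
  have "(u \<otimes> v) \<otimes> (u \<otimes> v) = (u \<otimes> u) \<otimes> (v \<otimes> v)" using a(2) b(2) by algebra
  then have "u \<otimes> v \<in> idempotents R" using a b by (simp add: idempotents_def)
  moreover have "(a \<oplus> b) \<otimes> (u \<otimes> v) = (a \<otimes> u) \<otimes> v \<oplus> (b \<otimes> v) \<otimes> u"
    using a(1,2) b(1,2) by algebra
  moreover have "u \<otimes> v \<notin> P" using a b P.I_prime by blast
  ultimately show "a \<oplus> b \<in> idempotent_ideal R P"
    unfolding idempotent_ideal_def using a b
    by (intro CollectI conjI bexI[of _ "u \<otimes> v"]) auto
next
  fix a x assume "a \<in> idempotent_ideal R P" "x \<in> carrier R"
  moreover from this have "(x \<otimes> a) \<otimes> u = \<zero>" if "u \<in> idempotents R" "a \<otimes> u = \<zero>" for u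
    using that by (auto simp: idempotent_ideal_def idempotents_def m_assoc)
  ultimately show "x \<otimes> a \<in> idempotent_ideal R P"
    by (auto simp: idempotent_ideal_def)
qed (auto simp: idempotent_ideal_def)

text \<open>This identifies V(\<open>idempotent_ideal R P\<close>) as the primes that cannot be told
  apart from \<open>P\<close> by idempotents. An idempotent \<open>e\<close> in \<open>P\<close> is
  killed by 1 - e, which is outside \<open>P\<close>, so it belongs to the ideal.\<close>

lemma (in cring) idempotent_ideal_subset_iff:
  assumes P: "primeideal P R" and Q: "primeideal Q R"
  shows "idempotent_ideal R P \<subseteq> Q \<longleftrightarrow> idempotents R \<inter> P = idempotents R \<inter> Q"
proof
  interpret P: primeideal P R by fact
  interpret Q: primeideal Q R by fact
  assume sub: "idempotent_ideal R P \<subseteq> Q"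
  have *: "e \<in> Q" if e: "e \<in> idempotents R" "e \<in> P" for e
  proof -
    note compl = idempotent_compl[OF e(1)]
    have c: "e \<in> carrier R" "\<one> \<ominus> e \<in> carrier R"
      using e compl by (auto simp: idempotents_def)
    then have "\<one> \<ominus> e \<notin> P" using P.compl_mem_iff[OF c compl(2,3)] e by blast
    then have "e \<in> idempotent_ideal R P"
      using c compl(1,2) by (auto simp: idempotent_ideal_def)
    then show ?thesis using sub by blast
  qed
  have "e \<in> P" if e: "e \<in> idempotents R" "e \<in> Q" for e
  proof -
    note compl = idempotent_compl[OF e(1)]
    have c: "e \<in> carrier R" "\<one> \<ominus> e \<in> carrier R"
      using e compl by (auto simp: idempotents_def)
    \<comment> \<open>If \<open>e\<close> were outside \<open>P\<close>, then 1 - e would lie in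
      \<open>P\<close> and hence, by \<open>*\<close>, in \<open>Q\<close> together with
      \<open>e\<close>. So inclusion of the idempotents already forces equality.\<close>
    show ?thesis
      using P.compl_mem_iff[OF c compl(2,3)] Q.compl_mem_iff[OF c compl(2,3)] *[OF compl(1)] e
      by blast
  qed
  with * show "idempotents R \<inter> P = idempotents R \<inter> Q" by blast
next
  interpret Q: primeideal Q R by fact
  assume eq: "idempotents R \<inter> P = idempotents R \<inter> Q"
  show "idempotent_ideal R P \<subseteq> Q"
  proof
    fix y assume "y \<in> idempotent_ideal R P"
    then obtain u where "y \<in> carrier R" "u \<in> idempotents R" "u \<notin> P" "y \<otimes> u = \<zero>"
      by (auto simp: idempotent_ideal_def)
    with eq show "y \<in> Q" using Q.I_prime[of y u] Q.zero_closed by (auto simp: idempotents_def)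
  qed
qed

text \<open>A separation of \<open>V(I)\<close> would yield \<open>a + b = 1\<close> with \<open>ab\<close> nilpotent modulo \<open>I\<close>, and hence
  orthogonal idempotents \<open>g\<close>, \<open>h\<close> with \<open>g + h\<close> outside \<open>P\<close>; one of the two lies in \<open>I\<close>.\<close>

lemma (in cring) connectedin_vanishing_locus_idempotent_ideal:
  assumes P: "primeideal P R"
  shows "connectedin (zariski_topology R) (vanishing_locus R (idempotent_ideal R P))"
proof -
  interpret P: primeideal P R by fact
  let ?I = "idempotent_ideal R P"
  let ?V = "vanishing_locus R ?I"
  interpret I: ideal ?I R using ideal_idempotent_ideal[OF P] .
  have disj: False if EF: "E \<subseteq> carrier R" "F \<subseteq> carrier R"
      and cover: "?V \<subseteq> vanishing_locus R E \<union> vanishing_locus R F"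
      and dis: "vanishing_locus R E \<inter> vanishing_locus R F \<inter> ?V = {}"
      and ne: "vanishing_locus R E \<inter> ?V \<noteq> {}" "vanishing_locus R F \<inter> ?V \<noteq> {}"
    for E F
  proof -
    \<comment> \<open>Only \<open>?K\<close> absorbs \<open>?I\<close>: this suffices to make the
      two ideals comaximal, since by \<open>dis\<close> no prime contains \<open>E\<close>,
      \<open>F\<close> and \<open>?I\<close> at once.\<close>
    let ?J = "Idl E" and ?K = "Idl (F \<union> ?I)"
    have FI: "F \<union> ?I \<subseteq> carrier R" using EF I.a_subset by blast
    have J: "ideal ?J R" and K: "ideal ?K R" using genideal_ideal EF(1) FI by auto
    interpret J: ideal ?J R by fact
    interpret K: ideal ?K R by fact
    have "\<one> \<in> ?J <+>\<^bsub>R\<^esub> ?K"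
    proof (rule ccontr)
      assume "\<one> \<notin> ?J <+>\<^bsub>R\<^esub> ?K"
      then obtain Q where Q: "primeideal Q R" "?J <+>\<^bsub>R\<^esub> ?K \<subseteq> Q"
        using exists_primeideal_notin[OF add_ideals[OF J K], of \<one>] by auto
      interpret Q: primeideal Q R by fact
      have "?J \<union> ?K \<subseteq> ?J <+>\<^bsub>R\<^esub> ?K"
        using ideal_set_add_supset[OF J K] by blast
      then have "Q \<in> vanishing_locus R E \<inter> vanishing_locus R F \<inter> ?V"
        using Q genideal_self[OF EF(1)] genideal_self[OF FI]
        by (auto simp: vanishing_locus_def prime_spectrum_def)
      with dis show False by blast
    qed
    then obtain a b where ab: "a \<in> ?J" "b \<in> ?K" "a \<oplus> b = \<one>"
      unfolding set_add_def' by auto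
    have c: "a \<in> carrier R" "b \<in> carrier R" using ab J.Icarr K.Icarr by auto
    have aE: "a \<in> Q" if "Q \<in> vanishing_locus R E" for Q
      using that ab(1) genideal_minimal[of Q E]
      by (auto simp: vanishing_locus_def prime_spectrum_def primeideal_def)
    have bF: "b \<in> Q" if "Q \<in> vanishing_locus R F" "Q \<in> ?V" for Q
      using that ab(2) genideal_minimal[of Q "F \<union> ?I"]
      by (auto simp: vanishing_locus_def prime_spectrum_def primeideal_def)
    \<comment> \<open>By \<open>cover\<close>, every prime above \<open>?I\<close> contains
      \<open>a\<close> or \<open>b\<close>, so \<open>a \<otimes> b\<close> is nilpotent modulo
      \<open>?I\<close>.\<close>
    have "\<exists>n::nat. (a \<otimes> b) [^] n \<in> ?I"
    proof (rule ccontr)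
      assume "\<not> ?thesis"
      then obtain Q where Q: "primeideal Q R" "?I \<subseteq> Q" "a \<otimes> b \<notin> Q"
        using exists_primeideal_notin[OF I.is_ideal, of "a \<otimes> b"] c by auto
      interpret Q: primeideal Q R by fact
      have "Q \<in> ?V" using Q by (auto simp: vanishing_locus_def prime_spectrum_def)
      then have "a \<in> Q \<or> b \<in> Q" using cover aE bF by blast
      then show False using Q c Q.I_l_closed Q.I_r_closed by blast
    qed
    then obtain m :: nat where "(a \<otimes> b) [^] m \<in> ?I" by blast
    \<comment> \<open>The exponent is made positive so that \<open>a [^] n\<close> and
      \<open>b [^] n\<close> are multiples of \<open>a\<close> and \<open>b\<close>; this later puts
      \<open>g\<close> in \<open>Q1\<close> and \<open>h\<close> in \<open>Q2\<close>.\<close>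
    then have "(a \<otimes> b) [^] Suc m \<in> ?I" using c I.I_r_closed by simp
    then obtain n where n: "n = Suc m" and "(a \<otimes> b) [^] n \<in> ?I" by blast
    then obtain u where u: "u \<in> carrier R" "u \<otimes> u = u" "u \<notin> P"
      "(a \<otimes> b) [^] n \<otimes> u = \<zero>"
      unfolding idempotent_ideal_def idempotents_def by blast
    \<comment> \<open>Multiplying this partition of 1 by \<open>u\<close> splits \<open>u\<close>
      into \<open>g\<close> and \<open>h\<close>, whose product has the vanishing factor
      \<open>(a \<otimes> b) [^] n \<otimes> u\<close>.\<close>
    obtain r s where rs: "r \<in> carrier R" "s \<in> carrier R" "a [^] n \<otimes> r \<oplus> b [^] n \<otimes> s = \<one>"
      using comaximal_nat_pow[OF c ab(3)] by blast
    define g where "g = u \<otimes> (a [^] n \<otimes> r)"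
    define h where "h = u \<otimes> (b [^] n \<otimes> s)"
    have gh_c: "g \<in> carrier R" "h \<in> carrier R" using u rs c by (auto simp: g_def h_def)
    have gh_sum: "g \<oplus> h = u"
      using u rs c by (simp add: g_def h_def flip: r_distr)
    have "g \<otimes> h = ((a [^] n \<otimes> b [^] n) \<otimes> u) \<otimes> (u \<otimes> r \<otimes> s)"
      unfolding g_def h_def using u(1) rs(1,2) nat_pow_closed[OF c(1), of n] nat_pow_closed[OF c(2), of n]
      by algebra
    then have gh: "g \<otimes> h = \<zero>"
      using u rs c by (simp add: nat_pow_distrib)
    have "g \<otimes> u = g" "h \<otimes> u = h"
    proof -
      have "g \<otimes> u = (u \<otimes> u) \<otimes> (a [^] n \<otimes> r)" "h \<otimes> u = (u \<otimes> u) \<otimes> (b [^] n \<otimes> s)"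
        unfolding g_def h_def using u(1) rs(1,2) nat_pow_closed[OF c(1), of n] nat_pow_closed[OF c(2), of n]
        by algebra+
      then show "g \<otimes> u = g" "h \<otimes> u = h" using u by (simp_all add: g_def h_def)
    qed
    \<comment> \<open>Since gh = 0 and u = g + h, one gets g = gu = gg + gh = gg, and likewise for
      \<open>h\<close>.\<close>
    then have idem: "g \<in> idempotents R" "h \<in> idempotents R"
      using gh gh_c m_comm[of g h] r_distr[of g h g] r_distr[of g h h] gh_sum
      by (auto simp: idempotents_def)
    \<comment> \<open>Primes in \<open>?V\<close> contain the same idempotents as \<open>P\<close>,
      and \<open>u\<close> is outside \<open>P\<close>.\<close>
    have uQ: "u \<notin> Q" if "Q \<in> ?V" for Q
    proof -
      have "primeideal Q R" "?I \<subseteq> Q"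
        using that by (auto simp: vanishing_locus_def prime_spectrum_def)
      then have "idempotents R \<inter> P = idempotents R \<inter> Q"
        using idempotent_ideal_subset_iff[OF P] by blast
      then show ?thesis using u by (auto simp: idempotents_def)
    qed
    obtain Q1 Q2 where Q1: "Q1 \<in> vanishing_locus R E" "Q1 \<in> ?V"
      and Q2: "Q2 \<in> vanishing_locus R F" "Q2 \<in> ?V"
      using ne by blast
    interpret Q1: primeideal Q1 R using Q1 by (simp add: vanishing_locus_def prime_spectrum_def)
    interpret Q2: primeideal Q2 R using Q2 by (simp add: vanishing_locus_def prime_spectrum_def)
    have "g \<in> Q1"
      using aE[OF Q1(1)] u rs c Q1.I_l_closed Q1.I_r_closed by (simp add: g_def n)
    then have "h \<notin> Q1" using uQ[OF Q1(2)] gh_sum Q1.add_mem by metis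
    have "h \<in> Q2"
      using bF[OF Q2] u rs c Q2.I_l_closed Q2.I_r_closed by (simp add: h_def n)
    then have "g \<notin> Q2" using uQ[OF Q2(2)] gh_sum Q2.add_mem by metis
    \<comment> \<open>Whichever of \<open>g\<close>, \<open>h\<close> is outside \<open>P\<close>
      annihilates the other and so puts it in \<open>?I\<close>, hence in both \<open>Q1\<close> and
      \<open>Q2\<close>.\<close>
    have "g \<notin> P \<or> h \<notin> P" using u(3) gh_sum P.add_mem by metis
    moreover have "h \<otimes> g = \<zero>" using gh gh_c m_comm by simp
    ultimately have "g \<in> ?I \<or> h \<in> ?I"
      unfolding idempotent_ideal_def using idem gh gh_c by blast
    then show False
      using \<open>h \<notin> Q1\<close> \<open>g \<notin> Q2\<close> Q1(2) Q2(2) by (auto simp: vanishing_locus_def)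
  qed
  have "?V \<subseteq> topspace (zariski_topology R)"
    by (auto simp: topspace_zariski vanishing_locus_def)
  moreover have False if closed: "closedin (zariski_topology R) C" "closedin (zariski_topology R) D"
    and "?V \<subseteq> C \<union> D" "C \<inter> D \<inter> ?V = {}" "C \<inter> ?V \<noteq> {}" "D \<inter> ?V \<noteq> {}" for C D
  proof -
    obtain E F where "E \<subseteq> carrier R" "C = vanishing_locus R E"
      and "F \<subseteq> carrier R" "D = vanishing_locus R F"
      using closedin_zariskiE[OF closed(1)] closedin_zariskiE[OF closed(2)] by metis
    then show False using disj[of E F] that by simp
  qed
  ultimately show ?thesis
    unfolding connectedin_closedin by auto
qed

text \<open>Primes with equal idempotents both lie in the connected set
  V(\<open>idempotent_ideal R P\<close>); the converse is the clopen argument.\<close>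

lemma (in cring) connected_component_zariski_iff:
  assumes P: "primeideal P R" and Q: "primeideal Q R"
  shows "connected_component_of (zariski_topology R) P Q \<longleftrightarrow>
    idempotents R \<inter> P = idempotents R \<inter> Q"
proof
  assume "idempotents R \<inter> P = idempotents R \<inter> Q"
  then have "P \<in> vanishing_locus R (idempotent_ideal R P)"
    "Q \<in> vanishing_locus R (idempotent_ideal R P)"
    using idempotent_ideal_subset_iff P Q
    by (auto simp: vanishing_locus_def prime_spectrum_def)
  then show "connected_component_of (zariski_topology R) P Q"
    using connectedin_vanishing_locus_idempotent_ideal[OF P] connected_component_of_def by metis
qed (rule connected_component_imp_idempotents_eq)

lemma (in cring) connected_components_lepoll_Pow_idempotents:
  "connected_components_of (zariski_topology R) \<lesssim> Pow (idempotents R)"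
proof -
  \<comment> \<open>A component is recovered from the idempotents common to its primes. Sets
    \<open>E\<close> that are the trace of no prime go to the empty set; only covering all
    components matters.\<close>
  have "connected_components_of (zariski_topology R)
      \<subseteq> (\<lambda>E. {Q \<in> prime_spectrum R. E = idempotents R \<inter> Q}) ` Pow (idempotents R)"
  proof
    fix C assume "C \<in> connected_components_of (zariski_topology R)"
    then obtain P where P: "primeideal P R"
      and C: "C = connected_component_of_set (zariski_topology R) P"
      by (auto simp: connected_components_of_def topspace_zariski prime_spectrum_def)
    have "C = {Q \<in> prime_spectrum R. idempotents R \<inter> P = idempotents R \<inter> Q}"
      using connected_component_zariski_iff[OF P]
        connected_component_in_topspace[of "zariski_topology R" P]
      unfolding C prime_spectrum_def topspace_zariski by blast
    then show "C \<in> (\<lambda>E. {Q \<in> prime_spectrum R. E = idempotents R \<inter> Q}) ` Pow (idempotents R)"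
      by blast
  qed
  then show ?thesis by (rule subset_image_lepoll)
qed

section \<open>Products of rings\<close>

lemma idempotents_product_ring:
  "idempotents (product_ring S R) = (\<Pi>\<^sub>E k\<in>S. idempotents (R k))"
  by (auto simp: idempotents_def product_ring_def PiE_iff fun_eq_iff extensional_def restrict_def)

section \<open>Cardinality of products of finite sets\<close>

lemma lepoll_Pow_mono:
  assumes "A \<lesssim> B"
  shows "Pow A \<lesssim> Pow B"
proof -
  obtain f where "inj_on f A" "f ` A \<subseteq> B" using assms by (auto simp: lepoll_def)
  then have "inj_on (image f) (Pow A)" "image f ` Pow A \<subseteq> Pow B"
    using inj_on_image_Pow image_Pow_mono by blast+
  then show ?thesis unfolding lepoll_def by blast
qed

text \<open>Numbering each finite factor turns a function into its graph, a subset of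
  \<open>S \<times> UNIV\<close> over the naturals; that product embeds in
  \<open>S \<times> S\<close>, which is equipollent to the infinite set \<open>S\<close>.\<close>

lemma PiE_finite_lepoll_Pow:
  assumes "infinite S" and fin: "\<And>k. k \<in> S \<Longrightarrow> finite (B k)"
  shows "(\<Pi>\<^sub>E k\<in>S. B k) \<lesssim> Pow S"
proof -
  have "\<exists>f::'b \<Rightarrow> nat. inj_on f (B k)" if "k \<in> S" for k
    using finite_imp_inj_to_nat_seg[OF fin[OF that]] by blast
  then obtain f :: "'a \<Rightarrow> 'b \<Rightarrow> nat" where f: "\<And>k. k \<in> S \<Longrightarrow> inj_on (f k) (B k)"
    by metis
  define G where "G x = (\<lambda>k. (k, f k (x k))) ` S" for x
  have "inj_on G (\<Pi>\<^sub>E k\<in>S. B k)"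
  proof (rule inj_onI)
    fix x y assume xy: "x \<in> (\<Pi>\<^sub>E k\<in>S. B k)" "y \<in> (\<Pi>\<^sub>E k\<in>S. B k)" "G x = G y"
    show "x = y"
    proof (rule PiE_ext[OF xy(1,2)])
      fix k assume k: "k \<in> S"
      then have "(k, f k (x k)) \<in> G y" using xy(3) by (auto simp: G_def)
      then have "f k (x k) = f k (y k)" by (auto simp: G_def)
      then show "x k = y k" using f[OF k] xy k by (meson PiE_mem inj_onD)
    qed
  qed
  moreover have "G ` (\<Pi>\<^sub>E k\<in>S. B k) \<subseteq> Pow (S \<times> UNIV)"
    by (auto simp: G_def)
  ultimately have 1: "(\<Pi>\<^sub>E k\<in>S. B k) \<lesssim> Pow (S \<times> (UNIV :: nat set))"
    unfolding lepoll_def by blast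
  have "S \<times> (UNIV :: nat set) \<lesssim> S \<times> S"
    using assms(1) by (intro times_lepoll_mono) (auto simp: infinite_le_lepoll)
  also have "S \<times> S \<approx> S"
    using card_of_Times_same_infinite[OF assms(1)] by (simp add: eqpoll_iff_card_of_ordIso)
  finally have 2: "Pow (S \<times> (UNIV :: nat set)) \<lesssim> Pow S"
    by (rule lepoll_Pow_mono)
  show ?thesis using lepoll_trans[OF 1 2] .
qed

section \<open>Primes from families with the finite intersection property\<close>

definition product_indicator :: "'i set \<Rightarrow> ('i \<Rightarrow> ('a, 'm) ring_scheme) \<Rightarrow> 'i set \<Rightarrow> 'i \<Rightarrow> 'a"
  where "product_indicator S R A = (\<lambda>k\<in>S. if k \<in> A then \<one>\<^bsub>R k\<^esub> else \<zero>\<^bsub>R k\<^esub>)"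

text \<open>The elements vanishing on some finite intersection from \<open>\<F>\<close> form an
  ideal. It is proper, because every such intersection meets \<open>S\<close> and no factor is zero
  there; any prime above it works.\<close>

lemma exists_primeideal_product_ring:
  fixes S :: "'i set" and R :: "'i \<Rightarrow> ('a, 'm) ring_scheme"
  assumes R: "\<And>k. k \<in> S \<Longrightarrow> cring (R k)"
    and nz: "\<And>k. k \<in> S \<Longrightarrow> carrier (R k) \<noteq> {\<zero>\<^bsub>R k\<^esub>}"
    and fip: "\<And>\<G>. finite \<G> \<Longrightarrow> \<G> \<subseteq> \<F> \<Longrightarrow> S \<inter> \<Inter>\<G> \<noteq> {}"
  shows "\<exists>P. primeideal P (product_ring S R) \<and>
    (\<forall>A\<in>\<F>. product_indicator S R A \<notin> P \<and> product_indicator S R (S - A) \<in> P)"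
proof -
  let ?R = "product_ring S R"
  interpret cring ?R using cring_product_ring R .
  \<comment> \<open>The intersection with \<open>S\<close> gives the empty \<open>\<G>\<close> its
    meaning: \<open>\<Inter>{}\<close> is \<open>UNIV\<close>, so the condition becomes vanishing on
    all of \<open>S\<close>.\<close>
  define I where "I = {f \<in> carrier ?R.
    \<exists>\<G>. finite \<G> \<and> \<G> \<subseteq> \<F> \<and> (\<forall>k\<in>S \<inter> \<Inter>\<G>. f k = \<zero>\<^bsub>R k\<^esub>)}"
  have "ideal I ?R"
  proof (rule ideal_cringI)
    show "\<zero>\<^bsub>?R\<^esub> \<in> I"
      using zero_closed by (auto simp: I_def product_ring_def intro!: exI[of _ "{}"])
  next
    fix f g assume "f \<in> I" "g \<in> I"
    then obtain \<G> \<G>' where f: "f \<in> carrier ?R" "finite \<G>" "\<G> \<subseteq> \<F>" "\<forall>k\<in>S \<inter> \<Inter>\<G>. f k = \<zero>\<^bsub>R k\<^esub>"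
      and g: "g \<in> carrier ?R" "finite \<G>'" "\<G>' \<subseteq> \<F>" "\<forall>k\<in>S \<inter> \<Inter>\<G>'. g k = \<zero>\<^bsub>R k\<^esub>"
      by (auto simp: I_def)
    have "\<forall>k\<in>S \<inter> \<Inter>(\<G> \<union> \<G>'). (f \<oplus>\<^bsub>?R\<^esub> g) k = \<zero>\<^bsub>R k\<^esub>"
      using f(4) g(4) R by (auto simp: product_ring_def cring.cring_simprules(2,8))
    then show "f \<oplus>\<^bsub>?R\<^esub> g \<in> I"
      using f g by (auto simp: I_def intro!: exI[of _ "\<G> \<union> \<G>'"])
  next
    fix f x assume "f \<in> I" "x \<in> carrier ?R"
    moreover have "x k \<otimes>\<^bsub>R k\<^esub> \<zero>\<^bsub>R k\<^esub> = \<zero>\<^bsub>R k\<^esub>" if "k \<in> S" for k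
    proof -
      interpret Rk: cring "R k" using R[OF that] .
      show ?thesis using that \<open>x \<in> carrier ?R\<close> by (auto simp: product_ring_def PiE_iff)
    qed
    ultimately show "x \<otimes>\<^bsub>?R\<^esub> f \<in> I"
      using m_closed unfolding I_def by (auto simp: product_ring_def)
  qed (auto simp: I_def)
  moreover have "\<one>\<^bsub>?R\<^esub> \<notin> I"
  proof
    assume "\<one>\<^bsub>?R\<^esub> \<in> I"
    then obtain \<G> where \<G>: "finite \<G>" "\<G> \<subseteq> \<F>" "\<forall>k\<in>S \<inter> \<Inter>\<G>. \<one>\<^bsub>?R\<^esub> k = \<zero>\<^bsub>R k\<^esub>"
      by (auto simp: I_def)
    then obtain k where k: "k \<in> S" "k \<in> \<Inter>\<G>" using fip[OF \<G>(1,2)] by blast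
    interpret Rk: cring "R k" using R[OF k(1)] .
    have "\<one>\<^bsub>R k\<^esub> = \<zero>\<^bsub>R k\<^esub>" using \<G>(3) k by (auto simp: product_ring_def)
    then show False using nz[OF k(1)] Rk.one_zeroD by blast
  qed
  ultimately obtain P where P: "primeideal P ?R" "I \<subseteq> P"
    using exists_primeideal_notin[of I "\<one>\<^bsub>?R\<^esub>"] by auto
  interpret P: primeideal P ?R by fact
  have "product_indicator S R A \<notin> P \<and> product_indicator S R (S - A) \<in> P" if "A \<in> \<F>" for A
  proof -
    have c: "product_indicator S R B \<in> carrier ?R" for B
      using R by (auto simp: product_indicator_def product_ring_def cring.cring_simprules(2,6))
    have "\<forall>k\<in>S \<inter> \<Inter>{A}. product_indicator S R (S - A) k = \<zero>\<^bsub>R k\<^esub>"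
      by (simp add: product_indicator_def)
    then have "product_indicator S R (S - A) \<in> I"
      unfolding I_def using c[of "S - A"] that by (intro CollectI conjI exI[of _ "{A}"]) auto
    moreover have "product_indicator S R A \<oplus>\<^bsub>?R\<^esub> product_indicator S R (S - A) = \<one>\<^bsub>?R\<^esub>"
      using R by (auto simp: product_indicator_def product_ring_def fun_eq_iff
          cring.cring_simprules(2,6,8,16))
    ultimately show ?thesis
      using P(2) P.add_mem[of "product_indicator S R A" "product_indicator S R (S - A)"]
        P.one_notin by auto
  qed
  then show ?thesis using P(1) by blast
qed

section \<open>Independent families\<close>

text \<open>Hausdorff's construction: the sets \<open>{(F, \<G>). F \<inter> X \<in> \<G>}\<close> are independent in the set of
  pairs of a finite subset of \<open>S\<close> and a finite set of finite subsets of \<open>S\<close>.\<close>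

lemma independent_family:
  fixes S :: "'i set"
  assumes "infinite S"
  obtains A :: "'i set \<Rightarrow> 'i set" where "\<And>X. A X \<subseteq> S"
    and "\<And>\<X> \<Y>. finite \<Y> \<Longrightarrow> \<Y> \<subseteq> Pow S \<Longrightarrow> \<exists>k\<in>S. \<forall>X\<in>\<Y>. k \<in> A X \<longleftrightarrow> X \<in> \<X>"
proof -
  let ?T = "Fpow S \<times> Fpow (Fpow S)"
  have F: "Fpow S \<approx> S" using eqpoll_Fpow[OF assms] .
  then have "infinite (Fpow S)" using assms eqpoll_finite_iff by blast
  then have "Fpow (Fpow S) \<approx> S" using eqpoll_Fpow F eqpoll_trans by blast
  then have "?T \<approx> S \<times> S" using F by (intro times_eqpoll_cong)
  also have "S \<times> S \<approx> S"
    using card_of_Times_same_infinite[OF assms] by (simp add: eqpoll_iff_card_of_ordIso)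
  finally obtain h where h: "bij_betw h ?T S" by (auto simp: eqpoll_def)
  \<comment> \<open>The bijection \<open>h\<close> transports Hausdorff's sets of pairs to subsets
    of \<open>S\<close>.\<close>
  define A where "A X = h ` {(F, \<G>) \<in> ?T. F \<inter> X \<in> \<G>}" for X
  show ?thesis
  proof
    show "A X \<subseteq> S" for X using h by (auto simp: A_def bij_betw_def)
  next
    fix \<X> \<Y> :: "'i set set" assume Y: "finite \<Y>" "\<Y> \<subseteq> Pow S"
    define d where "d X Y = (SOME x. x \<in> X \<longleftrightarrow> x \<notin> Y)" for X Y :: "'i set"
    have d: "d X Y \<in> X \<longleftrightarrow> d X Y \<notin> Y" if "X \<noteq> Y" for X Y
      unfolding d_def by (rule someI_ex) (use that in blast)
    \<comment> \<open>\<open>F\<close> contains a separating point for any two distinct members of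
      \<open>\<Y>\<close>, so these have distinct traces on \<open>F\<close>. The values
      \<open>d X X\<close> are arbitrary, hence the intersection with \<open>S\<close>.\<close>
    define F where "F = S \<inter> (\<lambda>(X, Y). d X Y) ` (\<Y> \<times> \<Y>)"
    \<comment> \<open>These are the traces of exactly those members of \<open>\<Y>\<close> whose set
      \<open>A X\<close> should contain the point \<open>h (F, \<G>)\<close>.\<close>
    define \<G> where "\<G> = (\<inter>) F ` (\<Y> \<inter> \<X>)"
    have T: "(F, \<G>) \<in> ?T" using Y by (auto simp: F_def \<G>_def Fpow_def)
    have inj: "X = X'" if "X \<in> \<Y>" "X' \<in> \<Y>" "F \<inter> X = F \<inter> X'" for X X'
    proof (rule ccontr)
      assume "X \<noteq> X'"
      then have "d X X' \<in> X \<longleftrightarrow> d X X' \<notin> X'" by (rule d)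
      moreover from this have "d X X' \<in> F" using that Y by (auto simp: F_def)
      ultimately show False using that(3) by blast
    qed
    have "h (F, \<G>) \<in> A X \<longleftrightarrow> X \<in> \<X>" if X: "X \<in> \<Y>" for X
    proof -
      have "h (F, \<G>) \<in> A X \<longleftrightarrow> F \<inter> X \<in> \<G>"
        using h T by (auto simp: A_def bij_betw_def inj_on_def)
      also have "\<dots> \<longleftrightarrow> X \<in> \<X>" using X inj by (auto simp: \<G>_def)
      finally show ?thesis .
    qed
    moreover have "h (F, \<G>) \<in> S" using h T by (auto simp: bij_betw_def)
    ultimately show "\<exists>k\<in>S. \<forall>X\<in>\<Y>. k \<in> A X \<longleftrightarrow> X \<in> \<X>" by blast
  qed
qed

text \<open>Each \<open>\<X> \<subseteq> Pow S\<close> selects \<open>A X\<close> or its complement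
  for every \<open>X\<close>. Independence is the finite intersection property of the selection, and
  the resulting prime records \<open>\<X>\<close> in the indicators it contains; idempotents then
  separate the components.\<close>

lemma Pow_Pow_lepoll_connected_components:
  fixes S :: "'i set" and R :: "'i \<Rightarrow> ('a, 'm) ring_scheme"
  assumes S: "infinite S" and R: "\<And>k. k \<in> S \<Longrightarrow> cring (R k)"
    and nz: "\<And>k. k \<in> S \<Longrightarrow> carrier (R k) \<noteq> {\<zero>\<^bsub>R k\<^esub>}"
  shows "Pow (Pow S) \<lesssim> connected_components_of (zariski_topology (product_ring S R))"
proof -
  let ?R = "product_ring S R"
  interpret cring ?R using cring_product_ring R .
  obtain A :: "'i set \<Rightarrow> 'i set" where AS: "\<And>X. A X \<subseteq> S"
    and indep: "\<And>\<X> \<Y>. finite \<Y> \<Longrightarrow> \<Y> \<subseteq> Pow S \<Longrightarrow> \<exists>k\<in>S. \<forall>X\<in>\<Y>. k \<in> A X \<longleftrightarrow> X \<in> \<X>"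
    by (rule independent_family[OF S]) (rule that)
  let ?e = "\<lambda>X. product_indicator S R (A X)"
  have "\<forall>\<X>. \<exists>P. primeideal P ?R \<and> (\<forall>X\<in>Pow S. ?e X \<in> P \<longleftrightarrow> X \<notin> \<X>)"
  proof
    fix \<X> :: "'i set set"
    define B where "B X = (if X \<in> \<X> then A X else S - A X)" for X
    have fip: "S \<inter> \<Inter>\<G> \<noteq> {}" if G: "finite \<G>" "\<G> \<subseteq> B ` Pow S" for \<G>
    proof -
      obtain \<Y> where Y: "finite \<Y>" "\<Y> \<subseteq> Pow S" "\<G> = B ` \<Y>"
        using finite_subset_image[OF G] by blast
      obtain k where "k \<in> S" "\<forall>X\<in>\<Y>. k \<in> A X \<longleftrightarrow> X \<in> \<X>"
        using indep[OF Y(1,2)] by blast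
      then have "k \<in> S \<inter> \<Inter>\<G>" by (auto simp: Y(3) B_def)
      then show ?thesis by blast
    qed
    have "\<exists>P. primeideal P ?R \<and>
        (\<forall>D\<in>B ` Pow S. product_indicator S R D \<notin> P \<and> product_indicator S R (S - D) \<in> P)"
      by (rule exists_primeideal_product_ring[OF R nz fip])
    then obtain P where P: "primeideal P ?R" "\<forall>D\<in>B ` Pow S.
        product_indicator S R D \<notin> P \<and> product_indicator S R (S - D) \<in> P"
      by blast
    \<comment> \<open>For \<open>X \<notin> \<X>\<close> the selected set is \<open>S - A X\<close>,
      whose complement in \<open>S\<close> is again \<open>A X\<close> because
      \<open>A X \<subseteq> S\<close>.\<close>
    have "?e X \<in> P \<longleftrightarrow> X \<notin> \<X>" if "X \<in> Pow S" for X
      using bspec[OF P(2) imageI[OF that]] AS[of X] by (cases "X \<in> \<X>") (auto simp: B_def double_diff)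
    then show "\<exists>P. primeideal P ?R \<and> (\<forall>X\<in>Pow S. ?e X \<in> P \<longleftrightarrow> X \<notin> \<X>)"
      using P(1) by blast
  qed
  from choice[OF this] obtain P where P: "primeideal (P \<X>) ?R"
    and eP: "X \<in> Pow S \<Longrightarrow> ?e X \<in> P \<X> \<longleftrightarrow> X \<notin> \<X>" for \<X> X
    by blast
  have "\<one>\<^bsub>R k\<^esub> \<in> idempotents (R k)" "\<zero>\<^bsub>R k\<^esub> \<in> idempotents (R k)" if "k \<in> S" for k
  proof -
    interpret Rk: cring "R k" using R[OF that] .
    show "\<one>\<^bsub>R k\<^esub> \<in> idempotents (R k)" "\<zero>\<^bsub>R k\<^esub> \<in> idempotents (R k)"
      by (simp_all add: idempotents_def)
  qed
  then have idem: "?e X \<in> idempotents ?R" for X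
    by (simp add: idempotents_product_ring product_indicator_def)
  have top: "P \<X> \<in> topspace (zariski_topology ?R)" for \<X>
    using P by (simp add: topspace_zariski prime_spectrum_def)
  let ?C = "\<lambda>\<X>. connected_component_of_set (zariski_topology ?R) (P \<X>)"
  have "inj_on ?C (Pow (Pow S))"
  proof (rule inj_onI)
    fix \<X> \<Y> assume XY: "\<X> \<in> Pow (Pow S)" "\<Y> \<in> Pow (Pow S)" "?C \<X> = ?C \<Y>"
    have "P \<Y> \<in> ?C \<Y>" using top by (simp add: connected_component_of_refl)
    then have "connected_component_of (zariski_topology ?R) (P \<X>) (P \<Y>)" using XY(3) by blast
    then have "idempotents ?R \<inter> P \<X> = idempotents ?R \<inter> P \<Y>"
      by (rule connected_component_imp_idempotents_eq)
    then have "?e X \<in> P \<X> \<longleftrightarrow> ?e X \<in> P \<Y>" for X using idem by blast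
    then have *: "X \<in> \<X> \<longleftrightarrow> X \<in> \<Y>" if "X \<in> Pow S" for X using eP[OF that] by metis
    have "\<X> \<subseteq> Pow S" "\<Y> \<subseteq> Pow S" using XY(1,2) by simp_all
    then show "\<X> = \<Y>" using * by (metis subsetD subsetI subset_antisym)
  qed
  moreover have "?C ` Pow (Pow S) \<subseteq> connected_components_of (zariski_topology ?R)"
    using top by (auto simp: connected_component_in_connected_components_of)
  ultimately show ?thesis unfolding lepoll_def by (intro exI conjI)
qed

theorem theorem3p2:
  fixes S :: "'i set" and R :: "'i \<Rightarrow> ('a, 'm) ring_scheme"
  assumes "infinite S"
    and "\<And>k. k \<in> S \<Longrightarrow> cring (R k)"
    and "\<And>k. k \<in> S \<Longrightarrow> carrier (R k) \<noteq> {\<zero>\<^bsub>R k\<^esub>}"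
  shows "Pow (Pow S) \<lesssim> connected_components_of (zariski_topology (product_ring S R)) \<and>
    ((\<forall>k\<in>S. finite (idempotents (R k))) \<longrightarrow>
      connected_components_of (zariski_topology (product_ring S R)) \<approx> Pow (Pow S))"
proof (intro conjI impI)
  let ?R = "product_ring S R"
  interpret cring ?R using cring_product_ring assms(2) .
  show lower: "Pow (Pow S) \<lesssim> connected_components_of (zariski_topology ?R)"
    using assms by (rule Pow_Pow_lepoll_connected_components)
  assume fin: "\<forall>k\<in>S. finite (idempotents (R k))"
  have "idempotents ?R \<lesssim> Pow S"
    unfolding idempotents_product_ring using assms(1) fin by (intro PiE_finite_lepoll_Pow) auto
  then have "Pow (idempotents ?R) \<lesssim> Pow (Pow S)"
    by (rule lepoll_Pow_mono)
  then have "connected_components_of (zariski_topology ?R) \<lesssim> Pow (Pow S)"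
    using connected_components_lepoll_Pow_idempotents lepoll_trans by blast
  then show "connected_components_of (zariski_topology ?R) \<approx> Pow (Pow S)"
    using lower lepoll_antisym by blast
qed

end
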